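(* Let $y,z\in\mathcal Y$ with lattice vectors $y_\ell=y(\ell\varepsilon)$, $z_\ell=z(\ell\varepsilon)$, and suppose that $\min_\ell y'_\ell\ge\mu$ and $\min_\ell z'_\ell\ge\mu$ for some constant $\mu>0$, and that $y$ is a local minimizer of $E_{\rm a}$ on $\mathcal Y$. Let $e_\ell=y_\ell-z_\ell$. Then $$|E_{\rm a}(y)-E_{\rm a}(z)|\ \le\ C^E_{\rm Lip}\ \varepsilon\sum_{\ell=1}^N|e'_\ell|^2,\qquad C^E_{\rm Lip}=\tfrac12M_2([\mu,\infty))+2M_2([2\mu,\infty)),$$ where $M_2(S)=\sup_{\xi\in S}|\phi''(\xi)|$.
   Context: $N\in\mathbb N$, $\varepsilon=1/N$, $F>0$, $\phi\in C^3((0,\infty))$; the constants $M_2([\mu,\infty))$, $M_2([2\mu,\infty))$ are understood to be finite. For a vector $\mathbf w\in\mathbb R^{\mathbb Z}$, $w'_\ell=(w_\ell-w_{\ell-1})/\varepsilon$. $\mathcal U$ is the space of continuous 1-periodic functions on $\mathbb R$, affine on each interval $[(\ell-1)\varepsilon,\ell\varepsilon]$, $\ell\in\mathbb Z$, with zero mean on $[0,1]$; $\mathcal Y=\{Fx+u:u\in\mathcal U\}$. For a fixed load $f\in\mathcal U$ and $y=Fx+u\in\mathcal Y$ with $y'>0$, $$E_{\rm a}(y)=\varepsilon\sum_{\ell=1}^N\phi\Big(\frac{y_\ell-y_{\ell-1}}\varepsilon\Big)+\varepsilon\sum_{\ell=1}^N\phi\Big(\frac{y_\ell-y_{\ell-2}}\varepsilon\Big)-\varepsilon\sum_{\ell=1}^Nf(\ell\varepsilon)u(\ell\varepsilon).$$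 Local minimizers are with respect to the usual topology of the finite-dimensional affine space $\mathcal Y$. *)

theory Defs
  imports "HOL-Analysis.Analysis"
begin

definition eps :: "nat \<Rightarrow> real" where
  "eps N = 1 / real N"

definition lattice :: "nat \<Rightarrow> (real \<Rightarrow> real) \<Rightarrow> int \<Rightarrow> real" where
  "lattice N y l = y (of_int l * eps N)"

definition bdiff :: "nat \<Rightarrow> (int \<Rightarrow> real) \<Rightarrow> int \<Rightarrow> real" where
  "bdiff N w l = (w l - w (l - 1)) / eps N"

definition displacements :: "nat \<Rightarrow> (real \<Rightarrow> real) set" where
  "displacements N = {u.
     continuous_on UNIV u \<and>
     (\<forall>x. u (x + 1) = u x) \<and>
     (\<forall>l::int. \<exists>a b. \<forall>x \<in> {of_int (l - 1) * eps N .. of_int l * eps N}. u x = a * x + b) \<and>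
     integral {0..1} u = 0}"

definition deformations :: "nat \<Rightarrow> real \<Rightarrow> (real \<Rightarrow> real) set" where
  "deformations N F = {(\<lambda>x. F * x + u x) | u. u \<in> displacements N}"

(* The domain of the energy: phi is only meaningful on the positive half-line. *)
definition admissible :: "nat \<Rightarrow> real \<Rightarrow> (real \<Rightarrow> real) set" where
  "admissible N F = {y \<in> deformations N F. \<forall>l. bdiff N (lattice N y) l > 0}"

definition E_a ::
  "(real \<Rightarrow> real) \<Rightarrow> nat \<Rightarrow> real \<Rightarrow> (real \<Rightarrow> real) \<Rightarrow> (real \<Rightarrow> real) \<Rightarrow> real" where
  "E_a \<phi> N F f y =
     eps N * (\<Sum>l = 1..int N. \<phi> ((lattice N y l - lattice N y (l - 1)) / eps N))
   + eps N * (\<Sum>l = 1..int N. \<phi> ((lattice N y l - lattice N y (l - 2)) / eps N))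
   - eps N * (\<Sum>l = 1..int N. lattice N f l * lattice N (\<lambda>x. y x - F * x) l)"

(* Neighbourhoods of y are taken in the supremum norm of the difference v - y, a periodic
   piecewise affine function; on a finite-dimensional affine space all norms induce the
   same topology. *)
definition local_minimizer ::
  "(real \<Rightarrow> real) \<Rightarrow> nat \<Rightarrow> real \<Rightarrow> (real \<Rightarrow> real) \<Rightarrow> (real \<Rightarrow> real) \<Rightarrow> bool" where
  "local_minimizer \<phi> N F f y \<longleftrightarrow>
     y \<in> admissible N F \<and>
     (\<exists>\<delta>>0. \<forall>v \<in> admissible N F.
        (\<forall>x. \<bar>v x - y x\<bar> < \<delta>) \<longrightarrow> E_a \<phi> N F f y \<le> E_a \<phi> N F f v)"

(* Intended for open S only, where differentiability within S is differentiability. *)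
definition C_k_on :: "nat \<Rightarrow> (real \<Rightarrow> real) \<Rightarrow> real set \<Rightarrow> bool" where
  "C_k_on k g S \<longleftrightarrow>
     (\<forall>j<k. (deriv ^^ j) g differentiable_on S) \<and> continuous_on S ((deriv ^^ k) g)"

definition M2 :: "(real \<Rightarrow> real) \<Rightarrow> real set \<Rightarrow> real" where
  "M2 \<phi> S = (SUP \<xi>\<in>S. \<bar>(deriv ^^ 2) \<phi> \<xi>\<bar>)"

definition M2_finite :: "(real \<Rightarrow> real) \<Rightarrow> real set \<Rightarrow> bool" where
  "M2_finite \<phi> S \<longleftrightarrow> bdd_above ((\<lambda>\<xi>. \<bar>(deriv ^^ 2) \<phi> \<xi>\<bar>) ` S)"

definition C_Lip :: "(real \<Rightarrow> real) \<Rightarrow> real \<Rightarrow> real" where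
  "C_Lip \<phi> \<mu> = 1 / 2 * M2 \<phi> {\<mu>..} + 2 * M2 \<phi> {2 * \<mu>..}"

end

theory Submission
  imports Defs
begin

text \<open>On the segment from y to z the first variation of the energy at y vanishes, because y is an
interior local minimizer. What remains of the energy difference is the sum of the second-order
Taylor remainders of \<open>\<phi>\<close>, bounded by half the supremum of its second derivative times the squared
strain increments. The next-nearest-neighbour increments are sums of two consecutive
nearest-neighbour ones, so by periodicity their squares sum to at most four times the squares of
the latter.\<close>

section \<open>The space of displacements and its affine translate\<close>

lemma displacements_add_cmult:
  assumes "u \<in> displacements N" "v \<in> displacements N"
  shows "(\<lambda>x. u x + c * v x) \<in> displacements N"
proof -
  have cu: "continuous_on UNIV u" and cv: "continuous_on UNIV v"
    using assms by (auto simp: displacements_def)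
  have iu: "u integrable_on {0..1}" and iv: "(\<lambda>x. c * v x) integrable_on {0..1}"
    by (intro integrable_continuous_real continuous_intros continuous_on_subset[OF cu]
        continuous_on_subset[OF cv] subset_UNIV)+
  have "\<exists>a b. \<forall>x\<in>{of_int (l - 1) * eps N .. of_int l * eps N}. u x + c * v x = a * x + b" for l
  proof -
    obtain a b where 1: "\<forall>x\<in>{of_int (l - 1) * eps N .. of_int l * eps N}. u x = a * x + b"
      using assms(1) unfolding displacements_def by blast
    obtain a' b' where 2: "\<forall>x\<in>{of_int (l - 1) * eps N .. of_int l * eps N}. v x = a' * x + b'"
      using assms(2) unfolding displacements_def by blast
    have "u x + c * v x = (a + c * a') * x + (b + c * b')"
      if "x \<in> {of_int (l - 1) * eps N .. of_int l * eps N}" for x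
      using bspec[OF 1 that] bspec[OF 2 that] by (simp add: algebra_simps)
    then show ?thesis by blast
  qed
  moreover have "integral {0..1} (\<lambda>x. u x + c * v x) = 0"
    using assms integral_add[OF iu iv] by (simp add: displacements_def)
  ultimately show ?thesis
    using assms cu cv by (auto simp: displacements_def intro!: continuous_intros)
qed

text \<open>Compactness of \<open>{0..1}\<close> gives a bound there, and periodicity carries it to
  the whole line. The bound makes small multiples of a direction uniformly small.\<close>

lemma displacements_bounded:
  assumes "u \<in> displacements N"
  obtains B where "B > 0" "\<And>x. \<bar>u x\<bar> \<le> B"
proof -
  have per: "u (x + 1) = u x" for x
    using assms by (simp add: displacements_def)
  have pern: "u (x + of_nat n) = u x" for x n
  proof (induction n)
    case (Suc n)
    then show ?case using per[of "x + of_nat n"] by (simp add: ac_simps)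
  qed simp
  have perz: "u (x + of_int k) = u x" for x k
  proof (cases "k \<ge> 0")
    case True
    then show ?thesis using pern[of x "nat k"] by simp
  next
    case False
    \<comment> \<open>For negative \<open>k\<close>, the walk starts at \<open>x + of_int k\<close>
      and takes \<open>- k\<close> forward steps back to \<open>x\<close>.\<close>
    then show ?thesis using pern[of "x + of_int k" "nat (- k)"] by simp
  qed
  have "continuous_on {0..1} u"
    using assms continuous_on_subset by (auto simp: displacements_def)
  then have "bounded (u ` {0..1})"
    by (intro compact_imp_bounded compact_continuous_image) auto
  then obtain B where B: "B > 0" "\<And>x. x \<in> {0..1} \<Longrightarrow> \<bar>u x\<bar> \<le> B"
    by (auto simp: bounded_pos)
  have "\<bar>u x\<bar> \<le> B" for x
    using B(2)[of "frac x"] perz[of "frac x" "\<lfloor>x\<rfloor>"] frac_lt_1[of x]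
    by (simp add: frac_def)
  with B(1) that show ?thesis by blast
qed

lemma deformations_diff:
  assumes "y \<in> deformations N F" "z \<in> deformations N F"
  shows "(\<lambda>x. z x - y x) \<in> displacements N"
  using assms displacements_add_cmult[where c = "-1"]
  by (auto simp: deformations_def)

lemma deformations_add_cmult:
  assumes "y \<in> deformations N F" "w \<in> displacements N"
  shows "(\<lambda>x. y x + t * w x) \<in> deformations N F"
proof -
  obtain u where u: "u \<in> displacements N" "y = (\<lambda>x. F * x + u x)"
    using assms(1) by (auto simp: deformations_def)
  have "(\<lambda>x. y x + t * w x) = (\<lambda>x. F * x + (u x + t * w x))"
    by (simp add: u(2) add.assoc)
  then show ?thesis
    using displacements_add_cmult[OF u(1) assms(2), of t] by (auto simp: deformations_def)
qed

section \<open>Strains on the lattice and the energy in terms of them\<close>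

lemma bdiff_add_cmult:
  "bdiff N (\<lambda>l. p l + t * q l) l = bdiff N p l + t * bdiff N q l"
  by (simp add: bdiff_def add_divide_distrib[symmetric] diff_divide_distrib[symmetric] algebra_simps)

lemma lattice_add_cmult:
  "lattice N (\<lambda>x. y x + t * w x) = (\<lambda>l. lattice N y l + t * lattice N w l)"
  by (simp add: lattice_def fun_eq_iff)

lemma lattice_periodic:
  assumes "N \<ge> 1" "u \<in> displacements N"
  shows "lattice N u (l + int N) = lattice N u l"
proof -
  have "of_int (l + int N) * eps N = of_int l * eps N + 1"
    using assms(1) by (simp add: eps_def field_simps)
  then show ?thesis
    using assms(2) by (simp add: lattice_def displacements_def)
qed

lemma bdiff_lattice_periodic:
  assumes "N \<ge> 1" "u \<in> displacements N"
  shows "bdiff N (lattice N u) (l + int N) = bdiff N (lattice N u) l"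
  using lattice_periodic[OF assms, of l] lattice_periodic[OF assms, of "l - 1"]
  by (simp add: bdiff_def algebra_simps)

text \<open>A second-neighbour difference telescopes into two consecutive strains. In this form each
  argument of \<open>\<phi>\<close> is affine in the size of a perturbation.\<close>

lemma E_a_bdiff:
  "E_a \<phi> N F f y =
     eps N * (\<Sum>l = 1..int N. \<phi> (bdiff N (lattice N y) l))
   + eps N * (\<Sum>l = 1..int N. \<phi> (bdiff N (lattice N y) l + bdiff N (lattice N y) (l - 1)))
   - eps N * (\<Sum>l = 1..int N. lattice N f l * (lattice N y l - F * (of_int l * eps N)))"
  by (simp add: E_a_def bdiff_def add_divide_distrib[symmetric] lattice_def)

text \<open>Termwise, the right side of
  \<open>(p + q)\<^sup>2 \<le> 2 * p\<^sup>2 + 2 * q\<^sup>2\<close> exceeds the left by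
  \<open>(p - q)\<^sup>2\<close>. The shifted sum of squares equals the unshifted one, since
  \<open>g 0\<close> at one end can be traded for \<open>g n\<close> at the other.\<close>

lemma sum_square_add_pred_le:
  fixes g :: "int \<Rightarrow> real"
  assumes "g 0 = g n" "n \<ge> 1"
  shows "(\<Sum>l = 1..n. (g l + g (l - 1))\<^sup>2) \<le> 4 * (\<Sum>l = 1..n. (g l)\<^sup>2)"
proof -
  have "(\<Sum>l = 1..n. (g (l - 1))\<^sup>2) = (\<Sum>l = 0..n - 1. (g l)\<^sup>2)"
    by (rule sum.reindex_bij_witness[of _ "\<lambda>l. l + 1" "\<lambda>l. l - 1"]) auto
  also have "\<dots> = (g 0)\<^sup>2 + (\<Sum>l = 1..n - 1. (g l)\<^sup>2)"
  proof -
    have "{0..n - 1} = insert 0 {1..n - 1}" using assms(2) by auto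
    then show ?thesis by simp
  qed
  also have "\<dots> = (\<Sum>l = 1..n. (g l)\<^sup>2)"
  proof -
    have "{1..n} = insert n {1..n - 1}" using assms(2) by auto
    then show ?thesis by (simp add: assms(1))
  qed
  finally have shift: "(\<Sum>l = 1..n. (g (l - 1))\<^sup>2) = (\<Sum>l = 1..n. (g l)\<^sup>2)" .
  have "(\<Sum>l = 1..n. (g l + g (l - 1))\<^sup>2) \<le> (\<Sum>l = 1..n. 2 * (g l)\<^sup>2 + 2 * (g (l - 1))\<^sup>2)"
  proof (rule sum_mono)
    fix l
    show "(g l + g (l - 1))\<^sup>2 \<le> 2 * (g l)\<^sup>2 + 2 * (g (l - 1))\<^sup>2"
      using zero_le_power2[of "g l - g (l - 1)"] by (simp add: power2_eq_square algebra_simps)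
  qed
  also have "\<dots> = 4 * (\<Sum>l = 1..n. (g l)\<^sup>2)"
    by (simp add: sum.distrib sum_distrib_left[symmetric] shift)
  finally show ?thesis .
qed

section \<open>Taylor expansion of the potential\<close>

lemma C_k_on_has_deriv:
  assumes "C_k_on k \<phi> S" "open S" "j < k" "x \<in> S"
  shows "((deriv ^^ j) \<phi> has_field_derivative (deriv ^^ Suc j) \<phi> x) (at x)"
proof -
  have "(deriv ^^ j) \<phi> differentiable at x"
    using assms by (metis C_k_on_def differentiable_on_def at_within_open)
  then show ?thesis
    by (simp add: DERIV_deriv_iff_real_differentiable)
qed

text \<open>In the Lagrange form of the remainder the intermediate point lies between
  \<open>a\<close> and \<open>b\<close>, hence in \<open>{m..}\<close>, where \<open>M2\<close>
  bounds the second derivative. As \<open>m > 0\<close>, this half-line lies where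
  \<open>\<phi>\<close> is smooth.\<close>

lemma taylor_remainder_M2:
  assumes "C_k_on 3 \<phi> {0<..}" "m > 0" "M2_finite \<phi> {m..}" "a \<ge> m" "b \<ge> m"
  shows "\<bar>\<phi> b - \<phi> a - deriv \<phi> a * (b - a)\<bar> \<le> M2 \<phi> {m..} / 2 * (b - a)\<^sup>2"
proof (cases "a = b")
  case False
  have D: "\<forall>k t. k < 2 \<and> min a b \<le> t \<and> t \<le> max a b \<longrightarrow>
      DERIV ((deriv ^^ k) \<phi>) t :> (deriv ^^ Suc k) \<phi> t"
    using assms by (intro allI impI C_k_on_has_deriv[OF assms(1)]) auto
  obtain t where t: "if b < a then b < t \<and> t < a else a < t \<and> t < b"
    and eq: "\<phi> b = (\<Sum>k<2. (deriv ^^ k) \<phi> a / fact k * (b - a) ^ k)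
      + (deriv ^^ 2) \<phi> t / fact 2 * (b - a) ^ 2"
    using Taylor[of 2 "\<lambda>k. (deriv ^^ k) \<phi>" \<phi> "min a b" "max a b" a b, OF _ _ D] False
    by auto
  have "\<bar>(deriv ^^ 2) \<phi> t\<bar> \<le> M2 \<phi> {m..}"
    unfolding M2_def using assms t
    by (intro cSUP_upper) (auto simp: M2_finite_def split: if_splits)
  moreover have "\<phi> b - \<phi> a - deriv \<phi> a * (b - a) = (deriv ^^ 2) \<phi> t / 2 * (b - a)\<^sup>2"
    using eq by (simp add: lessThan_nat_numeral lessThan_Suc numeral_2_eq_2)
  ultimately show ?thesis
    by (simp only: abs_mult abs_divide power2_abs) (simp add: mult_right_mono)
qed simp

section \<open>First variation and the equilibrium equation\<close>

text \<open>This is the directional derivative of the energy at \<open>y\<close> along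
  \<open>w\<close>. The macroscopic strain \<open>F\<close> is absent because it enters the load
  term only as an additive constant.\<close>

definition first_variation ::
  "(real \<Rightarrow> real) \<Rightarrow> nat \<Rightarrow> (real \<Rightarrow> real) \<Rightarrow> (real \<Rightarrow> real) \<Rightarrow> (real \<Rightarrow> real) \<Rightarrow> real" where
  "first_variation \<phi> N f y w =
     eps N * (\<Sum>l = 1..int N. deriv \<phi> (bdiff N (lattice N y) l) * bdiff N (lattice N w) l)
   + eps N * (\<Sum>l = 1..int N.
       deriv \<phi> (bdiff N (lattice N y) l + bdiff N (lattice N y) (l - 1))
       * (bdiff N (lattice N w) l + bdiff N (lattice N w) (l - 1)))
   - eps N * (\<Sum>l = 1..int N. lattice N f l * lattice N w l)"

lemma E_a_has_first_variation:
  assumes C: "C_k_on 3 \<phi> {0<..}" and pos: "\<And>l. bdiff N (lattice N y) l > 0"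
  shows "((\<lambda>t. E_a \<phi> N F f (\<lambda>x. y x + t * w x)) has_field_derivative
    first_variation \<phi> N f y w) (at 0)"
proof -
  have D: "((\<lambda>t. \<phi> (a + t * c)) has_field_derivative deriv \<phi> a * c) (at 0)" if "a > 0" for a c
  proof -
    have "(\<phi> has_field_derivative deriv \<phi> a) (at (a + 0 * c))"
      using C_k_on_has_deriv[OF C, of 0 a] that by simp
    moreover have "((\<lambda>t. a + t * c) has_field_derivative c) (at 0)"
      by (auto intro!: derivative_eq_intros)
    ultimately show ?thesis
      by (rule DERIV_chain2)
  qed
  \<comment> \<open>This regroups the sum of two perturbed strains as one affine function of
    \<open>t\<close>, stated in the shape that the unfolded energy has.\<close>
  have D2: "((\<lambda>t. \<phi> (a + t * c + (a' + t * c'))) has_field_derivative deriv \<phi> (a + a') * (c + c'))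
      (at 0)" if "a + a' > 0" for a a' c c'
    using D[OF that, of "c + c'"] by (simp add: algebra_simps)
  have pos2: "bdiff N (lattice N y) l + bdiff N (lattice N y) (l - 1) > 0" for l
    using pos[of l] pos[of "l - 1"] by simp
  have L: "((\<lambda>t. k * (a + t * c - d)) has_field_derivative k * c) (at 0)" for a c d k :: real
    by (auto intro!: derivative_eq_intros)
  show ?thesis
    unfolding E_a_bdiff first_variation_def lattice_add_cmult bdiff_add_cmult
    by (intro DERIV_add DERIV_diff DERIV_cmult DERIV_sum D D2 L pos pos2)
qed

text \<open>Fermat's rule along the line \<open>y + t * w\<close>: for small \<open>t\<close> its
  points are admissible and close to \<open>y\<close>, so \<open>t = 0\<close> is a local minimum of
  a differentiable function.\<close>

lemma first_variation_eq_0: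
  assumes "N \<ge> 1" and C: "C_k_on 3 \<phi> {0<..}" and "\<mu> > 0"
    and mu: "\<And>l. bdiff N (lattice N y) l \<ge> \<mu>"
    and min: "local_minimizer \<phi> N F f y" and w: "w \<in> displacements N"
  shows "first_variation \<phi> N f y w = 0"
proof -
  obtain B where B: "B > 0" "\<And>x. \<bar>w x\<bar> \<le> B"
    using displacements_bounded[OF w] by blast
  have y: "y \<in> deformations N F"
    using min by (simp add: local_minimizer_def admissible_def)
  obtain \<delta> where \<delta>: "\<delta> > 0" "\<And>v. v \<in> admissible N F \<Longrightarrow> (\<And>x. \<bar>v x - y x\<bar> < \<delta>) \<Longrightarrow>
      E_a \<phi> N F f y \<le> E_a \<phi> N F f v"
    using min by (auto simp: local_minimizer_def)
  have eps: "eps N > 0" using assms(1) by (simp add: eps_def)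
  \<comment> \<open>A strain of \<open>w\<close> is a difference of two values of size at most
    \<open>B\<close>, divided by \<open>eps N\<close>.\<close>
  define K where "K = 2 * B / eps N"
  have K: "K > 0" using B eps by (simp add: K_def)
  have bw: "\<bar>bdiff N (lattice N w) l\<bar> \<le> K" for l
    using B(2)[of "of_int l * eps N"] B(2)[of "of_int (l - 1) * eps N"] eps
    by (auto simp: bdiff_def lattice_def K_def intro!: divide_right_mono)
  \<comment> \<open>The first bound keeps the perturbation in the
    \<open>\<delta>\<close>-neighbourhood; the second changes each strain by less than
    \<open>\<mu>\<close>, so all strains stay positive.\<close>
  define d where "d = min (\<delta> / B) (\<mu> / K)"
  have d: "d > 0" using \<delta>(1) B(1) assms(3) K by (simp add: d_def)
  have "E_a \<phi> N F f (\<lambda>x. y x + 0 * w x) \<le> E_a \<phi> N F f (\<lambda>x. y x + t * w x)" if t: "\<bar>0 - t\<bar> < d" for t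
  proof -
    have "\<bar>t\<bar> < \<delta> / B" "\<bar>t\<bar> < \<mu> / K" using t by (auto simp: d_def)
    then have tB: "\<bar>t\<bar> * B < \<delta>" and tK: "\<bar>t\<bar> * K < \<mu>"
      using B(1) K by (auto simp: pos_less_divide_eq)
    have "\<bar>t * bdiff N (lattice N w) l\<bar> < \<mu>" for l
      using mult_left_mono[OF bw[of l], of "\<bar>t\<bar>"] tK by (simp add: abs_mult)
    then have "bdiff N (lattice N (\<lambda>x. y x + t * w x)) l > 0" for l
      using mu[of l] unfolding lattice_add_cmult bdiff_add_cmult by (smt (verit))
    then have "(\<lambda>x. y x + t * w x) \<in> admissible N F"
      using deformations_add_cmult[OF y w, of t] by (simp add: admissible_def)
    moreover have "\<bar>(y x + t * w x) - y x\<bar> < \<delta>" for x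
      using mult_left_mono[OF B(2)[of x], of "\<bar>t\<bar>"] tB by (simp add: abs_mult)
    ultimately show ?thesis
      using \<delta>(2) by simp
  qed
  then show ?thesis
    using DERIV_local_min[OF E_a_has_first_variation[OF C] d] mu assms(3)
    by (meson less_le_trans)
qed

section \<open>The quadratic energy estimate\<close>

theorem lemma9:
  fixes N :: nat and F \<mu> :: real and \<phi> f y z :: "real \<Rightarrow> real" and e :: "int \<Rightarrow> real"
  assumes "N \<ge> 1" and "F > 0"
    and "C_k_on 3 \<phi> {0<..}"
    and "f \<in> displacements N"
    and "\<mu> > 0"
    and "M2_finite \<phi> {\<mu>..}" and "M2_finite \<phi> {2 * \<mu>..}"
    and "y \<in> deformations N F" and "z \<in> deformations N F"
    and "\<forall>l. bdiff N (lattice N y) l \<ge> \<mu>"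
    and "\<forall>l. bdiff N (lattice N z) l \<ge> \<mu>"
    and "local_minimizer \<phi> N F f y"
    and "\<And>l. e l = lattice N y l - lattice N z l"
  shows "\<bar>E_a \<phi> N F f y - E_a \<phi> N F f z\<bar>
           \<le> C_Lip \<phi> \<mu> * (eps N * (\<Sum>l = 1..int N. \<bar>bdiff N e l\<bar>\<^sup>2))"
proof -
  define w where "w = (\<lambda>x. z x - y x)"
  have w: "w \<in> displacements N"
    using deformations_diff[OF assms(8,9)] by (simp add: w_def)
  define a where "a = bdiff N (lattice N y)"
  define b where "b = bdiff N (lattice N z)"
  define g where "g = bdiff N (lattice N w)"
  define S where "S = (\<Sum>l = 1..int N. (g l)\<^sup>2)"
  have eps: "eps N > 0" using assms(1) by (simp add: eps_def)
  have g: "g l = b l - a l" for l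
    by (simp add: a_def b_def g_def w_def bdiff_def lattice_def diff_divide_distrib)
  have am: "a l \<ge> \<mu>" and bm: "b l \<ge> \<mu>" for l
    using assms(10,11) by (auto simp: a_def b_def)
  have am2: "a l + a (l - 1) \<ge> 2 * \<mu>" and bm2: "b l + b (l - 1) \<ge> 2 * \<mu>" for l
    using am[of l] am[of "l - 1"] bm[of l] bm[of "l - 1"] by simp_all
  \<comment> \<open>\<open>R1\<close> and \<open>R2\<close> are the first-order Taylor remainders of
    the nearest and next-nearest neighbour terms.\<close>
  define R1 where "R1 l = \<phi> (b l) - \<phi> (a l) - deriv \<phi> (a l) * g l" for l
  define R2 where "R2 l = \<phi> (b l + b (l - 1)) - \<phi> (a l + a (l - 1))
      - deriv \<phi> (a l + a (l - 1)) * (g l + g (l - 1))" for l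
  have R1: "\<bar>R1 l\<bar> \<le> M2 \<phi> {\<mu>..} / 2 * (g l)\<^sup>2" for l
    using taylor_remainder_M2[OF assms(3,5,6) am[of l] bm[of l]] by (simp add: R1_def g)
  have R2: "\<bar>R2 l\<bar> \<le> M2 \<phi> {2 * \<mu>..} / 2 * (g l + g (l - 1))\<^sup>2" for l
  proof -
    have "g l + g (l - 1) = (b l + b (l - 1)) - (a l + a (l - 1))"
      by (simp add: g)
    then show ?thesis
      using taylor_remainder_M2[OF assms(3) _ assms(7) am2[of l] bm2[of l]] assms(5)
      by (simp only: R2_def)
  qed
  have "\<bar>\<Sum>l = 1..int N. R1 l\<bar> \<le> (\<Sum>l = 1..int N. M2 \<phi> {\<mu>..} / 2 * (g l)\<^sup>2)"
    by (rule order_trans[OF sum_abs sum_mono[OF R1]])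
  then have S1: "\<bar>\<Sum>l = 1..int N. R1 l\<bar> \<le> M2 \<phi> {\<mu>..} / 2 * S"
    by (simp only: S_def sum_distrib_left)
  \<comment> \<open>One value of the bounded family already shows that the supremum is nonnegative,
    so that it can multiply an inequality below.\<close>
  have "\<bar>(deriv ^^ 2) \<phi> (2 * \<mu>)\<bar> \<le> M2 \<phi> {2 * \<mu>..}"
    unfolding M2_def using assms(7) by (intro cSUP_upper) (auto simp: M2_finite_def)
  then have M0: "M2 \<phi> {2 * \<mu>..} \<ge> 0" by linarith
  have "\<bar>\<Sum>l = 1..int N. R2 l\<bar> \<le> (\<Sum>l = 1..int N. M2 \<phi> {2 * \<mu>..} / 2 * (g l + g (l - 1))\<^sup>2)"
    by (rule order_trans[OF sum_abs sum_mono[OF R2]])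
  also have "\<dots> = M2 \<phi> {2 * \<mu>..} / 2 * (\<Sum>l = 1..int N. (g l + g (l - 1))\<^sup>2)"
    by (simp only: sum_distrib_left)
  also have "\<dots> \<le> M2 \<phi> {2 * \<mu>..} / 2 * (4 * S)"
    unfolding S_def using M0 assms(1) bdiff_lattice_periodic[OF assms(1) w, of 0]
    by (intro mult_left_mono sum_square_add_pred_le) (auto simp: g_def)
  finally have S2: "\<bar>\<Sum>l = 1..int N. R2 l\<bar> \<le> 2 * M2 \<phi> {2 * \<mu>..} * S"
    by (simp add: ac_simps)
  \<comment> \<open>The load is affine in the deformation: its change is exactly its part of the
    first variation and leaves no remainder.\<close>
  have load: "(\<Sum>l = 1..int N. lattice N f l * (lattice N z l - F * (of_int l * eps N)))
      = (\<Sum>l = 1..int N. lattice N f l * (lattice N y l - F * (of_int l * eps N)))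
      + (\<Sum>l = 1..int N. lattice N f l * lattice N w l)"
    by (simp add: sum.distrib[symmetric] w_def lattice_def algebra_simps)
  have "first_variation \<phi> N f y w = 0"
    using first_variation_eq_0[OF assms(1,3,5) _ assms(12) w] assms(10) by blast
  \<comment> \<open>The linear Taylor terms and the load change add up to the first variation, which
    vanishes.\<close>
  then have "E_a \<phi> N F f z - E_a \<phi> N F f y =
      eps N * ((\<Sum>l = 1..int N. R1 l) + (\<Sum>l = 1..int N. R2 l))"
    unfolding E_a_bdiff first_variation_def load R1_def R2_def a_def[symmetric] b_def[symmetric]
      g_def[symmetric] sum_subtractf
    by (simp add: algebra_simps)
  then have "\<bar>E_a \<phi> N F f y - E_a \<phi> N F f z\<bar> =
      eps N * \<bar>(\<Sum>l = 1..int N. R1 l) + (\<Sum>l = 1..int N. R2 l)\<bar>"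
    using eps by (simp add: abs_minus_commute[of "E_a \<phi> N F f y"] abs_mult)
  also have "\<dots> \<le> eps N * (C_Lip \<phi> \<mu> * S)"
    using S1 S2 eps unfolding C_Lip_def
    by (intro mult_left_mono order_trans[OF abs_triangle_ineq]) (auto simp: algebra_simps)
  also have "\<dots> = C_Lip \<phi> \<mu> * (eps N * S)" by simp
  also have "S = (\<Sum>l = 1..int N. \<bar>bdiff N e l\<bar>\<^sup>2)"
  proof -
    \<comment> \<open>\<open>e\<close> is \<open>y\<close> minus \<open>z\<close> while
      \<open>w\<close> points from \<open>y\<close> to \<open>z\<close>; squaring removes the
      sign.\<close>
    have "bdiff N e l = - g l" for l
      by (simp add: assms(13) g a_def b_def bdiff_def diff_divide_distrib)
    then show ?thesis by (simp add: S_def)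
  qed
  finally show ?thesis .
qed

end
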